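(* Let $S=\mathbb{A}^2_{\mathbb{C}}$ and $T=(\mathbb{C}^\times)^2$. The $T$-fixed points of the nested Hilbert scheme $S^{[n,n+1]}$ are indexed by pairs $$(\lambda,c),\qquad \lambda\vdash n+1,\qquad c\in C(\lambda),$$ where $C(\lambda)$ is the set of removable corners of the Young diagram of $\lambda$. The nested ideal pair corresponding to $(\lambda,c)$ is $$I_\lambda\subset I_{\lambda\setminus c}.$$
   Context: Let $R=\mathbb{C}[x,y]$, $S=\operatorname{Spec}R$. The nested Hilbert scheme $S^{[n,n+1]}\subset S^{[n+1]}\times S^{[n]}$ is the closed incidence subscheme of pairs $(Z,Y)$ of zero-dimensional closed subschemes of $S$ of lengths $n+1$ and $n$ with $Y\subset Z$; its closed points are pairs of ideals $I\subset J\subset R$ with $\dim_{\mathbb{C}}R/I=n+1$, $\dim_{\mathbb{C}}R/J=n$. The torus $T$ acts on $S$ by $(q,t)\cdot(a,b)=(qa,tb)$, on $R$ by $((q,t)\cdot f)(x,y)=f(q^{-1}x,t^{-1}y)$, and on ideals by $\tau\cdot I=\{\tau\cdot f:f\in I\}$, hence on $S^{[n,n+1]}$ by $\tau\cdot(I\subset J)=(\tau\cdot I\subset\tau\cdot J)$. A partition $\lambda\vdash m$ is a finite nonincreasing sequence of positive integers $\lambda=(\lambda_0\ge\cdots\ge\lambda_{r-1}>0)$ with sum $m$; its Young diagram is $D(\lambda)=\{(i,j)\in\mathbb{N}^2:0\le j<r,\ 0\le i<\lambda_j\}$ (with $0\in\mathbb{N}$), and $I_\lambda=\langle x^iy^j:(i,j)\notin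 D(\lambda)\rangle\subset R$. A box $c=(i,j)\in D(\lambda)$ is a removable corner if $(i+1,j)\notin D(\lambda)$ and $(i,j+1)\notin D(\lambda)$; then $\lambda\setminus c$ denotes the partition with Young diagram $D(\lambda)\setminus\{c\}$. *)

theory Defs
  imports Complex_Main "HOL-Computational_Algebra.Polynomial"
begin

text \<open>The ring \<open>\<complex>[x,y]\<close> is represented as \<open>\<complex>[x][y]\<close>: the outer variable is \<open>y\<close> and
  the coefficients are polynomials in \<open>x\<close>.\<close>

type_synonym cpoly2 = "complex poly poly"

definition var_x :: cpoly2 where
  "var_x = [:[:0, 1:]:]"

definition var_y :: cpoly2 where
  "var_y = [:0, 1:]"

text \<open>Ideals are submodules of the ring regarded as a module over itself, so that
  \<^const>\<open>module.span\<close> for this module is the ideal generated by a set.\<close>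

interpretation cpoly2_self: module "(*) :: cpoly2 \<Rightarrow> cpoly2 \<Rightarrow> cpoly2"
  by unfold_locales (simp_all add: algebra_simps)

definition is_ideal :: "cpoly2 set \<Rightarrow> bool" where
  "is_ideal I \<longleftrightarrow> module.subspace ((*) :: cpoly2 \<Rightarrow> cpoly2 \<Rightarrow> cpoly2) I"

definition generated_ideal :: "cpoly2 set \<Rightarrow> cpoly2 set" where
  "generated_ideal A = module.span ((*) :: cpoly2 \<Rightarrow> cpoly2 \<Rightarrow> cpoly2) A"

text \<open>\<open>quotient_dim I n\<close> says that the complex vector space \<open>\<complex>[x,y]/I\<close> has dimension \<open>n\<close>:
  there are \<open>b 0, \<dots>, b (n - 1)\<close> whose residue classes span the quotient and are linearly
  independent in it. The complex number \<open>c\<close> acts on \<^typ>\<open>cpoly2\<close> as \<open>smult [:c:]\<close>. For \<open>n = 0\<close>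
  this means that \<open>I\<close> is the whole ring.\<close>

definition quotient_dim :: "cpoly2 set \<Rightarrow> nat \<Rightarrow> bool" where
  "quotient_dim I n \<longleftrightarrow>
     (\<exists>b :: nat \<Rightarrow> cpoly2.
        (\<forall>f. \<exists>c :: nat \<Rightarrow> complex. f - (\<Sum>k<n. smult [:c k:] (b k)) \<in> I) \<and>
        (\<forall>c :: nat \<Rightarrow> complex. (\<Sum>k<n. smult [:c k:] (b k)) \<in> I \<longrightarrow> (\<forall>k<n. c k = 0)))"

text \<open>The closed points of the nested Hilbert scheme of the affine plane, as pairs \<open>(I, J)\<close>
  in the order of \<open>S\<^sup>[\<^sup>n\<^sup>+\<^sup>1\<^sup>] \<times> S\<^sup>[\<^sup>n\<^sup>]\<close>.\<close>

definition nested_hilbert :: "nat \<Rightarrow> (cpoly2 set \<times> cpoly2 set) set" where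
  "nested_hilbert n =
     {(I, J). is_ideal I \<and> is_ideal J \<and> I \<subseteq> J \<and> quotient_dim I (n + 1) \<and> quotient_dim J n}"

definition torus :: "(complex \<times> complex) set" where
  "torus = {(q, t). q \<noteq> 0 \<and> t \<noteq> 0}"

text \<open>\<open>((q, t) \<cdot> f)(x, y) = f(q\<^sup>-\<^sup>1 x, t\<^sup>-\<^sup>1 y)\<close>: the inner composition substitutes for \<open>x\<close> in each
  coefficient, the outer one substitutes for \<open>y\<close>.\<close>

definition torus_act_poly :: "complex \<times> complex \<Rightarrow> cpoly2 \<Rightarrow> cpoly2" where
  "torus_act_poly = (\<lambda>(q, t) f.
     pcompose (map_poly (\<lambda>p. pcompose p [:0, inverse q:]) f) [:0, [:inverse t:]:])"

lemma poly_torus_act_poly: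
  "poly (poly (torus_act_poly (q, t) f) [:b:]) a =
   poly (poly f [:inverse t * b:]) (inverse q * a)"
  unfolding torus_act_poly_def
  by (induction f) (simp_all add: map_poly_pCons pcompose_pCons poly_pcompose algebra_simps)

definition torus_act_ideal :: "complex \<times> complex \<Rightarrow> cpoly2 set \<Rightarrow> cpoly2 set" where
  "torus_act_ideal \<tau> I = torus_act_poly \<tau> ` I"

definition torus_act_pair ::
    "complex \<times> complex \<Rightarrow> cpoly2 set \<times> cpoly2 set \<Rightarrow> cpoly2 set \<times> cpoly2 set" where
  "torus_act_pair \<tau> = (\<lambda>(I, J). (torus_act_ideal \<tau> I, torus_act_ideal \<tau> J))"

definition torus_fixed_points :: "nat \<Rightarrow> (cpoly2 set \<times> cpoly2 set) set" where
  "torus_fixed_points n = {P \<in> nested_hilbert n. \<forall>\<tau>\<in>torus. torus_act_pair \<tau> P = P}"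

definition is_partition :: "nat list \<Rightarrow> bool" where
  "is_partition l \<longleftrightarrow> sorted_wrt (\<ge>) l \<and> (\<forall>k\<in>set l. k > 0)"

definition partitions_of :: "nat \<Rightarrow> nat list set" where
  "partitions_of m = {l. is_partition l \<and> sum_list l = m}"

definition young_diagram :: "nat list \<Rightarrow> (nat \<times> nat) set" where
  "young_diagram l = {(i, j). j < length l \<and> i < l ! j}"

definition monomial_ideal :: "nat list \<Rightarrow> cpoly2 set" where
  "monomial_ideal l = generated_ideal {var_x ^ i * var_y ^ j | i j. (i, j) \<notin> young_diagram l}"

definition removable_corners :: "nat list \<Rightarrow> (nat \<times> nat) set" where
  "removable_corners l =
     {(i, j). (i, j) \<in> young_diagram l \<and> (i + 1, j) \<notin> young_diagram l \<and>
        (i, j + 1) \<notin> young_diagram l}"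

definition remove_box :: "nat list \<Rightarrow> nat \<times> nat \<Rightarrow> nat list" where
  "remove_box l c = (THE m. is_partition m \<and> young_diagram m = young_diagram l - {c})"

lemma young_diagram_inj:
  assumes l: "is_partition l" and m: "is_partition m"
    and eq: "young_diagram l = young_diagram m"
  shows "l = m"
proof (rule nth_equalityI)
  have len: "j < length k \<longleftrightarrow> (0, j) \<in> young_diagram k" if "is_partition k" for j k
    using that by (auto simp: is_partition_def young_diagram_def)
  have "j < length l \<longleftrightarrow> j < length m" for j
    using len[OF l] len[OF m] eq by simp
  then show *: "length l = length m"
    by (meson linorder_neqE_nat less_irrefl)
  fix j assume j: "j < length l"
  have "i < l ! j \<longleftrightarrow> i < m ! j" for i
    using eq j * by (auto simp: young_diagram_def set_eq_iff)
  then show "l ! j = m ! j"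
    by (meson linorder_neqE_nat less_irrefl)
qed

lemma remove_box_well_defined:
  assumes l: "is_partition l" and c: "c \<in> removable_corners l"
  shows "is_partition (remove_box l c)"
    and "young_diagram (remove_box l c) = young_diagram l - {c}"
proof -
  obtain i j where ij: "c = (i, j)" by (cases c)
  have j: "j < length l" and lj: "l ! j = i + 1"
    and nx: "j + 1 < length l \<Longrightarrow> l ! (j + 1) \<le> i"
    using c by (auto simp: ij removable_corners_def young_diagram_def)
  have sorted: "l ! b \<le> l ! a" if "a \<le> b" "b < length l" for a b
    using l that by (cases "a = b") (auto simp: is_partition_def sorted_wrt_iff_nth_less)
  have pos: "l ! a > 0" if "a < length l" for a
    using l that by (auto simp: is_partition_def)
  have "\<exists>m. is_partition m \<and> young_diagram m = young_diagram l - {c}"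
  proof (cases "i = 0")
    case True
    have last: "length l = Suc j"
      using nx pos[of "j + 1"] j True by (cases "j + 1 < length l") auto
    have "is_partition (take j l)"
      using l by (auto simp: is_partition_def sorted_wrt_take dest: in_set_takeD)
    moreover have "young_diagram (take j l) = young_diagram l - {c}"
      using last lj True by (auto simp: young_diagram_def ij less_Suc_eq)
    ultimately show ?thesis by blast
  next
    case False
    have "(l[j := i]) ! b \<le> (l[j := i]) ! a" if ab: "a < b" "b < length l" for a b
    proof (cases "a = j")
      case True
      then have "l ! b \<le> l ! (j + 1)" "l ! (j + 1) \<le> i"
        using sorted[of "j + 1" b] nx ab by simp_all
      then show ?thesis using True ab by simp
    next
      case False
      then show ?thesis using sorted[of a b] lj ab by (cases "b = j") simp_all
    qed
    then have "is_partition (l[j := i])"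
      using False pos j by (auto simp: is_partition_def sorted_wrt_iff_nth_less in_set_conv_nth nth_list_update)
    moreover have "young_diagram (l[j := i]) = young_diagram l - {c}"
      using lj j by (auto simp: young_diagram_def ij nth_list_update split: if_splits)
    ultimately show ?thesis by blast
  qed
  then have "\<exists>!m. is_partition m \<and> young_diagram m = young_diagram l - {c}"
    using young_diagram_inj by metis
  from theI'[OF this]
  show "is_partition (remove_box l c)" "young_diagram (remove_box l c) = young_diagram l - {c}"
    by (simp_all add: remove_box_def)
qed

end

theory Submission imports Defs
begin

text \<open>
  The monomials \<open>x\<^sup>i y\<^sup>j\<close> are simultaneous eigenvectors of the torus with pairwise distinct
  characters. Hence an ideal is fixed by the torus only if it contains every monomial that occurs
  in one of its elements (\<open>torus_stable_contains_monomials\<close>), so it consists of all polynomials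
  whose monomials have their exponents in some set \<open>A \<subseteq> \<nat>\<^sup>2\<close>
  (\<open>torus_stable_imp_supported_on\<close>). Such a set is closed under increasing either exponent;
  conversely every \<open>A\<close> closed in this way gives a torus-fixed ideal, generated by its monomials.

  The monomials outside \<open>A\<close> form a basis of the quotient, so its dimension is the number of boxes
  of the complement of \<open>A\<close> (\<open>quotient_dim_supported_on_iff\<close>), and a finite complement is the
  Young diagram of a partition (\<open>young_diagram_of_finite_down_set\<close>).

  A fixed nested pair therefore amounts to two diagrams with \<open>n + 1\<close> and \<open>n\<close> boxes, the
  second contained in the first. They differ in a single box, and the smaller set is a diagram
  exactly when this box is a removable corner of the larger one.
\<close>

section \<open>Monomials and supports\<close>

definition monomial :: "nat \<times> nat \<Rightarrow> cpoly2" where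
  "monomial = (\<lambda>(i, j). monom (monom 1 i) j)"

definition bicoeff :: "cpoly2 \<Rightarrow> nat \<times> nat \<Rightarrow> complex" where
  "bicoeff f = (\<lambda>(i, j). coeff (coeff f j) i)"

definition support :: "cpoly2 \<Rightarrow> (nat \<times> nat) set" where
  "support f = {m. bicoeff f m \<noteq> 0}"

text \<open>The monomial ideals are the sets \<open>supported_on A\<close> with \<open>A\<close> up-closed. For arbitrary \<open>A\<close> these
  are still complex subspaces: those of \<open>A\<close> and of its complement are complementary.\<close>

definition supported_on :: "(nat \<times> nat) set \<Rightarrow> cpoly2 set" where
  "supported_on A = {f. support f \<subseteq> A}"

definition up_closed :: "(nat \<times> nat) set \<Rightarrow> bool" where
  "up_closed A \<longleftrightarrow> (\<forall>i j i' j'. (i, j) \<in> A \<longrightarrow> i \<le> i' \<longrightarrow> j \<le> j' \<longrightarrow> (i', j') \<in> A)"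

lemma var_power_eq_monomial: "var_x ^ i * var_y ^ j = monomial (i, j)"
proof -
  have x: "var_x ^ i = [:monom 1 i:]"
    by (induction i) (simp_all add: var_x_def monom_Suc one_pCons mult.commute)
  have "var_y ^ j = monom 1 j"
    by (induction j) (simp_all add: var_y_def monom_Suc)
  then show ?thesis
    by (simp add: x monomial_def smult_monom)
qed

lemma bicoeff_eqI: "(\<And>m. bicoeff f m = bicoeff g m) \<Longrightarrow> f = g"
  by (intro poly_eqI) (metis (no_types, lifting) bicoeff_def case_prod_conv)

lemma bicoeff_simps [simp]:
  "bicoeff 0 m = 0"
  "bicoeff (f + g) m = bicoeff f m + bicoeff g m"
  "bicoeff (f - g) m = bicoeff f m - bicoeff g m"
  "bicoeff (smult [:c:] f) m = c * bicoeff f m"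
  by (simp_all add: bicoeff_def split: prod.splits)

lemma bicoeff_sum: "bicoeff (\<Sum>k\<in>K. F k) m = (\<Sum>k\<in>K. bicoeff (F k) m)"
  by (induction K rule: infinite_finite_induct) simp_all

lemma bicoeff_monomial: "bicoeff (monomial m') m = (if m = m' then 1 else 0)"
  by (auto simp: bicoeff_def monomial_def split: prod.splits)

lemma finite_support: "finite (support f)"
proof -
  have "support f \<subseteq> (\<lambda>(j, i). (i, j)) ` (SIGMA j:{..degree f}. {..degree (coeff f j)})"
  proof
    fix m assume "m \<in> support f"
    then obtain i j where m: "m = (i, j)" and nz: "coeff (coeff f j) i \<noteq> 0"
      by (cases m) (auto simp: support_def bicoeff_def)
    have "i \<le> degree (coeff f j)" using nz by (rule le_degree)
    moreover have "j \<le> degree f" using nz by (intro le_degree) auto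
    ultimately show "m \<in> (\<lambda>(j, i). (i, j)) ` (SIGMA j:{..degree f}. {..degree (coeff f j)})"
      by (force simp: m)
  qed
  then show ?thesis by (rule finite_subset) auto
qed

text \<open>\<open>restrict_poly A\<close> is the linear projection onto \<open>supported_on A\<close> that kills the monomials
  outside \<open>A\<close>. It serves both to expand a polynomial in monomials and as a concrete model of the
  quotient by \<open>supported_on (- A)\<close>.\<close>

definition restrict_poly :: "(nat \<times> nat) set \<Rightarrow> cpoly2 \<Rightarrow> cpoly2" where
  "restrict_poly A f = (\<Sum>m\<in>support f \<inter> A. smult [:bicoeff f m:] (monomial m))"

lemma bicoeff_restrict_poly: "bicoeff (restrict_poly A f) m = (if m \<in> A then bicoeff f m else 0)"
proof -
  have "bicoeff (restrict_poly A f) m = (\<Sum>m'\<in>support f \<inter> A. if m = m' then bicoeff f m' else 0)"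
    unfolding restrict_poly_def bicoeff_sum by (intro sum.cong) (auto simp: bicoeff_monomial)
  also have "\<dots> = (if m \<in> support f \<inter> A then bicoeff f m else 0)"
    using finite_support by simp
  finally show ?thesis by (auto simp: support_def)
qed

lemma supported_on_iff: "f \<in> supported_on A \<longleftrightarrow> (\<forall>m. m \<notin> A \<longrightarrow> bicoeff f m = 0)"
  by (auto simp: supported_on_def support_def)

lemma restrict_poly_supported_on: "f \<in> supported_on A \<Longrightarrow> restrict_poly A f = f"
  by (rule bicoeff_eqI) (auto simp: bicoeff_restrict_poly supported_on_def support_def)

lemma monomial_in_supported_on: "monomial m \<in> supported_on A \<longleftrightarrow> m \<in> A"
  by (auto simp: supported_on_def support_def bicoeff_monomial)

lemma supported_on_subset_iff: "supported_on A \<subseteq> supported_on B \<longleftrightarrow> A \<subseteq> B"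
proof
  show "A \<subseteq> B" if "supported_on A \<subseteq> supported_on B"
    using that monomial_in_supported_on by blast
qed (auto simp: supported_on_def)

lemma supported_on_eq_iff: "supported_on A = supported_on B \<longleftrightarrow> A = B"
  by (metis supported_on_subset_iff subset_antisym order_refl)

section \<open>Monomial ideals\<close>

text \<open>A monomial of a product \<open>g * f\<close> is the product of a monomial of \<open>g\<close> with one of \<open>f\<close>, so it lies
  above a monomial of \<open>f\<close>.\<close>

lemma is_ideal_supported_on:
  assumes "up_closed A"
  shows "is_ideal (supported_on A)"
  unfolding is_ideal_def
proof (rule cpoly2_self.subspaceI)
  show "0 \<in> supported_on A" by (simp add: supported_on_def support_def)
next
  fix f g assume "f \<in> supported_on A" "g \<in> supported_on A"
  then show "f + g \<in> supported_on A" by (force simp: supported_on_def support_def)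
next
  fix g f assume f: "f \<in> supported_on A"
  have "m \<in> A" if nz: "bicoeff (g * f) m \<noteq> 0" for m
  proof -
    obtain i j where m: "m = (i, j)" by (cases m)
    have "(\<Sum>b\<le>j. \<Sum>a\<le>i. coeff (coeff g b) a * coeff (coeff f (j - b)) (i - a)) \<noteq> 0"
      using nz by (simp add: m bicoeff_def coeff_mult coeff_sum)
    then obtain a b where "coeff (coeff f (j - b)) (i - a) \<noteq> 0"
      by (metis (no_types, lifting) mult_zero_right sum.neutral)
    then have "(i - a, j - b) \<in> A"
      using f by (auto simp: supported_on_def support_def bicoeff_def)
    then show ?thesis
      using assms unfolding up_closed_def m by (meson diff_le_self)
  qed
  then show "g * f \<in> supported_on A" by (auto simp: supported_on_def support_def)
qed

lemma is_ideal_smult: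
  assumes "is_ideal I" "f \<in> I"
  shows "smult [:c:] f \<in> I"
  using cpoly2_self.subspace_scale[of I f "[:[:c:]:]"] assms by (simp add: is_ideal_def)

lemma generated_ideal_monomial:
  assumes "up_closed A"
  shows "generated_ideal (monomial ` A) = supported_on A"
proof
  show "generated_ideal (monomial ` A) \<subseteq> supported_on A"
    unfolding generated_ideal_def
    using is_ideal_supported_on[OF assms]
    by (intro cpoly2_self.span_minimal) (auto simp: monomial_in_supported_on is_ideal_def)
next
  have gen: "is_ideal (generated_ideal (monomial ` A))"
    by (simp add: is_ideal_def generated_ideal_def)
  show "supported_on A \<subseteq> generated_ideal (monomial ` A)"
  proof
    fix f assume "f \<in> supported_on A"
    then have f: "f = restrict_poly A f" by (simp add: restrict_poly_supported_on)
    have "smult [:bicoeff f m:] (monomial m) \<in> generated_ideal (monomial ` A)" if "m \<in> A" for m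
      using that by (intro is_ideal_smult[OF gen])
        (auto simp: generated_ideal_def intro: cpoly2_self.span_base)
    then have "restrict_poly A f \<in> generated_ideal (monomial ` A)"
      using gen unfolding restrict_poly_def is_ideal_def by (intro cpoly2_self.subspace_sum) auto
    with f show "f \<in> generated_ideal (monomial ` A)" by simp
  qed
qed

lemma up_closed_Compl_young_diagram:
  assumes "is_partition l"
  shows "up_closed (- young_diagram l)"
  unfolding up_closed_def
proof (intro allI impI)
  fix i j i' j' assume ij: "(i, j) \<in> - young_diagram l" "i \<le> i'" "j \<le> j'"
  have "l ! j' \<le> l ! j" if "j' < length l"
    using assms that ij(3)
    by (cases "j = j'") (auto simp: is_partition_def sorted_wrt_iff_nth_less)
  with ij show "(i', j') \<in> - young_diagram l"
    by (auto simp: young_diagram_def)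
qed

lemma monomial_ideal_eq_supported_on:
  assumes "is_partition l"
  shows "monomial_ideal l = supported_on (- young_diagram l)"
proof -
  have "{var_x ^ i * var_y ^ j | i j. (i, j) \<notin> young_diagram l} = monomial ` (- young_diagram l)"
    by (auto simp: var_power_eq_monomial)
  then show ?thesis
    using generated_ideal_monomial[OF up_closed_Compl_young_diagram[OF assms]]
    by (simp add: monomial_ideal_def)
qed

section \<open>Torus-stable ideals\<close>

lemma bicoeff_torus_act:
  "bicoeff (torus_act_poly (q, t) f) (i, j) = inverse q ^ i * inverse t ^ j * bicoeff f (i, j)"
proof -
  have [simp]: "[:c:] ^ k = [:c ^ k:]" for c :: complex and k
    by (induction k) (simp_all add: one_pCons)
  show ?thesis
    by (simp add: torus_act_poly_def bicoeff_def coeff_pcompose_linear coeff_map_poly)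
qed

text \<open>The torus rescales coefficients, which cannot enlarge the support; acting by the inverse
  element gives the other inclusion.\<close>

lemma torus_act_supported_on:
  assumes "\<tau> \<in> torus"
  shows "torus_act_ideal \<tau> (supported_on A) = supported_on A"
proof -
  obtain q t where \<tau>: "\<tau> = (q, t)" and nz: "q \<noteq> 0" "t \<noteq> 0"
    using assms by (auto simp: torus_def)
  have stable: "torus_act_poly \<sigma> f \<in> supported_on A" if "f \<in> supported_on A" for f \<sigma>
    using that by (cases \<sigma>) (force simp: supported_on_def support_def bicoeff_torus_act)
  have inv: "torus_act_poly \<tau> (torus_act_poly (inverse q, inverse t) f) = f" for f
  proof (rule bicoeff_eqI)
    fix m
    show "bicoeff (torus_act_poly \<tau> (torus_act_poly (inverse q, inverse t) f)) m = bicoeff f m"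
      using nz by (cases m) (simp add: \<tau> bicoeff_torus_act power_inverse field_simps)
  qed
  show ?thesis
    unfolding torus_act_ideal_def
  proof (intro equalityI subsetI)
    fix f assume "f \<in> supported_on A"
    then show "f \<in> torus_act_poly \<tau> ` supported_on A"
      using stable inv by (metis imageI)
  qed (use stable in blast)
qed

text \<open>Since the powers of 2 are distinct, \<open>(2, 1)\<close> tells apart different exponents of \<open>x\<close>, and
  \<open>(1, 2)\<close> those of \<open>y\<close>.\<close>

lemma torus_separates_monomials:
  assumes "m \<noteq> m'"
  shows "\<exists>q t. (q, t) \<in> torus \<and>
    inverse q ^ fst m * inverse t ^ snd m \<noteq> inverse q ^ fst m' * inverse t ^ snd m'"
proof -
  have inj: "a \<noteq> b \<Longrightarrow> inverse (2::complex) ^ a \<noteq> inverse 2 ^ b" for a b :: nat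
    using power_inject_exp[of "2::real" a b]
    by (metis inverse_eq_iff_eq norm_numeral norm_power one_less_numeral_iff power_inverse
        semiring_norm(76))
  show ?thesis
  proof (cases "fst m = fst m'")
    case True
    then have "snd m \<noteq> snd m'" using assms by (simp add: prod_eq_iff)
    then show ?thesis
      by (intro exI[of _ 1] exI[of _ 2]) (use inj in \<open>auto simp: torus_def\<close>)
  next
    case False
    then show ?thesis
      by (intro exI[of _ 2] exI[of _ 1]) (use inj in \<open>auto simp: torus_def\<close>)
  qed
qed

text \<open>The monomials of \<open>f\<close> other than \<open>m\<close> can be removed one at a time. To remove \<open>m'\<close>, take a
  torus element \<open>\<tau>\<close> on which the characters of \<open>m\<close> and \<open>m'\<close> differ and subtract from
  \<open>\<tau> \<cdot> f\<close> the multiple of \<open>f\<close> with the same \<open>m'\<close>-coefficient: the difference stays in the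
  ideal, and the coefficient of \<open>m\<close> is only rescaled by a nonzero factor.\<close>

lemma torus_stable_contains_monomials:
  assumes I: "is_ideal I" and fixed: "\<And>\<tau>. \<tau> \<in> torus \<Longrightarrow> torus_act_ideal \<tau> I = I"
    and "f \<in> I" "m \<in> support f"
  shows "monomial m \<in> I"
  using assms(3,4)
proof (induction "card (support f)" arbitrary: f rule: less_induct)
  case less
  show ?case
  proof (cases "support f = {m}")
    case True
    have "smult [:inverse (bicoeff f m):] f = monomial m"
      using True by (intro bicoeff_eqI) (auto simp: support_def bicoeff_monomial set_eq_iff)
    then show ?thesis using is_ideal_smult[OF I less.prems(1)] by metis
  next
    case False
    then obtain m' where m': "m' \<in> support f" "m' \<noteq> m" using less.prems(2) by blast
    \<comment> \<open>the character by which \<open>(q, t)\<close> acts on the monomial with exponents \<open>k\<close>\<close>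
    define \<chi> :: "complex \<Rightarrow> complex \<Rightarrow> nat \<times> nat \<Rightarrow> complex"
      where "\<chi> q t k = inverse q ^ fst k * inverse t ^ snd k" for q t k
    obtain q t where qt: "(q, t) \<in> torus" "\<chi> q t m \<noteq> \<chi> q t m'"
      using torus_separates_monomials[of m m'] m'(2) by (auto simp: \<chi>_def)
    define g where "g = torus_act_poly (q, t) f - smult [:\<chi> q t m':] f"
    have bicoeff_g: "bicoeff g k = (\<chi> q t k - \<chi> q t m') * bicoeff f k" for k
      by (cases k) (simp add: g_def bicoeff_torus_act \<chi>_def algebra_simps)
    have "torus_act_poly (q, t) f \<in> I"
      using fixed[OF qt(1)] less.prems(1) by (auto simp: torus_act_ideal_def)
    then have "g \<in> I"
      using I is_ideal_smult[OF I less.prems(1)] unfolding g_def is_ideal_def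
      by (intro cpoly2_self.subspace_diff)
    moreover have "m \<in> support g"
      using qt(2) less.prems(2) by (simp add: support_def bicoeff_g)
    moreover have "support g \<subseteq> support f - {m'}" by (auto simp: support_def bicoeff_g)
    then have "card (support g) < card (support f)"
      using m'(1) by (intro psubset_card_mono finite_support) auto
    ultimately show ?thesis using less.hyps by blast
  qed
qed

lemma torus_stable_imp_supported_on:
  assumes I: "is_ideal I" and fixed: "\<And>\<tau>. \<tau> \<in> torus \<Longrightarrow> torus_act_ideal \<tau> I = I"
  obtains A where "up_closed A" "I = supported_on A"
proof
  define A where "A = {m. monomial m \<in> I}"
  show "up_closed A"
    unfolding up_closed_def
  proof (intro allI impI)
    fix i j i' j' :: nat assume *: "(i, j) \<in> A" "i \<le> i'" "j \<le> j'"
    have "monomial (i', j') = monomial (i' - i, j' - j) * monomial (i, j)"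
      using *(2,3) by (simp add: monomial_def mult_monom)
    then show "(i', j') \<in> A"
      using * I cpoly2_self.subspace_scale by (auto simp: A_def is_ideal_def)
  qed
  show "I = supported_on A"
  proof (intro equalityI subsetI)
    fix f assume "f \<in> I"
    then show "f \<in> supported_on A"
      using torus_stable_contains_monomials[OF I fixed] by (auto simp: supported_on_def A_def)
  next
    fix f assume "f \<in> supported_on A"
    then have "f = restrict_poly A f" by (simp add: restrict_poly_supported_on)
    moreover have "restrict_poly A f \<in> I"
      using I is_ideal_smult[OF I] unfolding restrict_poly_def is_ideal_def
      by (intro cpoly2_self.subspace_sum) (auto simp: A_def)
    ultimately show "f \<in> I" by simp
  qed
qed

section \<open>Colength\<close>

interpretation cplane: vector_space "\<lambda>(c::complex) (f::cpoly2). smult [:c:] f"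
  by unfold_locales (auto intro!: bicoeff_eqI simp: algebra_simps)

text \<open>The families in \<open>quotient_dim\<close> are indexed, whereas the dimension theory of vector spaces
  is about sets; injectivity makes the cardinalities agree.\<close>

lemma (in vector_space) independent_indexedI:
  fixes n :: nat
  assumes indep: "\<And>c. (\<Sum>k<n. scale (c k) (b k)) = 0 \<Longrightarrow> \<forall>k<n. c k = 0"
  shows "inj_on b {..<n}" "independent (b ` {..<n})"
proof -
  show inj: "inj_on b {..<n}"
  proof (rule inj_onI, rule ccontr)
    fix k l :: nat assume kl: "k \<in> {..<n}" "l \<in> {..<n}" "b k = b l" "k \<noteq> l"
    \<comment> \<open>a repeated vector gives the nontrivial relation \<open>b k - b l = 0\<close>\<close>
    define c where "c i = (if i = k then 1 else 0) - (if i = l then 1 else 0 :: 'a)" for i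
    have "scale (c i) (b i) = (if i = k then b k else 0) - (if i = l then b l else 0)" for i
      using kl(4) by (auto simp: c_def)
    then have "(\<Sum>i<n. scale (c i) (b i)) = b k - b l"
      using kl(1,2) by (simp add: sum_subtractf)
    then have "c k = 0" using indep[of c] kl(1,3) by simp
    then show False using kl(4) by (simp add: c_def)
  qed
  show "independent (b ` {..<n})"
  proof
    assume "dependent (b ` {..<n})"
    then obtain u where u: "\<exists>v\<in>b ` {..<n}. u v \<noteq> 0" "(\<Sum>v\<in>b ` {..<n}. scale (u v) v) = 0"
      using dependent_finite[of "b ` {..<n}"] by auto
    then have "(\<Sum>k<n. scale (u (b k)) (b k)) = 0"
      by (simp add: sum.reindex[OF inj])
    from indep[OF this] u(1) show False by auto
  qed
qed

lemma inj_monomial: "inj monomial"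
  by (rule injI) (metis bicoeff_monomial zero_neq_one)

lemma span_monomial: "cplane.span (monomial ` A) = supported_on A"
proof
  have "cplane.subspace (supported_on A)"
    by (rule cplane.subspaceI) (force simp: supported_on_def support_def)+
  then show "cplane.span (monomial ` A) \<subseteq> supported_on A"
    by (intro cplane.span_minimal) (auto simp: monomial_in_supported_on)
  show "supported_on A \<subseteq> cplane.span (monomial ` A)"
  proof
    fix f assume "f \<in> supported_on A"
    then have "f = restrict_poly A f" by (simp add: restrict_poly_supported_on)
    moreover have "restrict_poly A f \<in> cplane.span (monomial ` A)"
      unfolding restrict_poly_def
      by (intro cplane.span_sum cplane.span_scale cplane.span_base) auto
    ultimately show "f \<in> cplane.span (monomial ` A)" by simp
  qed
qed

lemma independent_monomial: "cplane.independent (monomial ` A)"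
proof
  assume "cplane.dependent (monomial ` A)"
  then obtain m where "m \<in> A" "monomial m \<in> cplane.span (monomial ` A - {monomial m})"
    by (auto simp: cplane.dependent_def)
  then have "monomial m \<in> cplane.span (monomial ` (A - {m}))"
    by (simp add: image_set_diff[OF inj_monomial])
  then show False by (simp add: span_monomial monomial_in_supported_on)
qed

text \<open>Restriction to the complement of \<open>E\<close> has kernel \<open>supported_on E\<close>, so it identifies the
  quotient with \<open>supported_on (- E)\<close>. A family representing a basis of the quotient is thereby sent
  to a basis of that space, and the monomials outside \<open>E\<close> are another one; two bases have the same
  cardinality. Conversely, the monomials outside \<open>E\<close> themselves represent a basis of the quotient.\<close>

lemma quotient_dim_supported_on_iff:
  "quotient_dim (supported_on E) n \<longleftrightarrow> finite (- E) \<and> card (- E) = n"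
proof
  assume "quotient_dim (supported_on E) n"
  then obtain b where
    gen: "\<And>f. \<exists>c. f - (\<Sum>k<n. smult [:c k:] (b k)) \<in> supported_on E" and
    indep: "\<And>c. (\<Sum>k<n. smult [:c k:] (b k)) \<in> supported_on E \<Longrightarrow> \<forall>k<n. c k = 0"
    unfolding quotient_dim_def by blast
  define p where "p k = restrict_poly (- E) (b k)" for k
  have comb: "(\<Sum>k<n. smult [:c k:] (p k)) = restrict_poly (- E) (\<Sum>k<n. smult [:c k:] (b k))" for c
    by (rule bicoeff_eqI) (simp add: p_def bicoeff_sum bicoeff_restrict_poly)
  have kernel: "f \<in> supported_on E \<longleftrightarrow> restrict_poly (- E) f = 0" for f
  proof
    assume "f \<in> supported_on E" then show "restrict_poly (- E) f = 0"
      by (intro bicoeff_eqI) (auto simp: bicoeff_restrict_poly supported_on_def support_def)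
  next
    assume "restrict_poly (- E) f = 0"
    then have "bicoeff f m = 0" if "m \<notin> E" for m
      using bicoeff_restrict_poly[of "- E" f m] that by simp
    then show "f \<in> supported_on E" by (auto simp: supported_on_def support_def)
  qed
  have "\<forall>k<n. c k = 0" if "(\<Sum>k<n. smult [:c k:] (p k)) = 0" for c
    using that indep by (simp add: comb kernel)
  then have p: "inj_on p {..<n}" "cplane.independent (p ` {..<n})"
    using cplane.independent_indexedI by blast+
  have p_support: "p k \<in> supported_on (- E)" for k
    by (auto simp: p_def supported_on_def support_def bicoeff_restrict_poly)
  have span_p: "cplane.span (p ` {..<n}) = supported_on (- E)"
  proof
    show "cplane.span (p ` {..<n}) \<subseteq> supported_on (- E)"
      using p_support cplane.subspace_span[of "monomial ` (- E)"]
      by (intro cplane.span_minimal) (auto simp: span_monomial)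
    show "supported_on (- E) \<subseteq> cplane.span (p ` {..<n})"
    proof
      fix f assume "f \<in> supported_on (- E)"
      then have f: "restrict_poly (- E) f = f" by (rule restrict_poly_supported_on)
      obtain c where "f - (\<Sum>k<n. smult [:c k:] (b k)) \<in> supported_on E" using gen by blast
      then have 0: "restrict_poly (- E) (f - (\<Sum>k<n. smult [:c k:] (b k))) = 0" by (simp add: kernel)
      have "restrict_poly (- E) f - (\<Sum>k<n. smult [:c k:] (p k)) = 0"
        unfolding 0[symmetric] comb by (rule bicoeff_eqI) (simp add: bicoeff_restrict_poly)
      then have "f = (\<Sum>k<n. smult [:c k:] (p k))" using f by simp
      also have "\<dots> \<in> cplane.span (p ` {..<n})"
        by (intro cplane.span_sum cplane.span_scale cplane.span_base) auto
      finally show "f \<in> cplane.span (p ` {..<n})" .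
    qed
  qed
  have fin: "finite (monomial ` (- E))"
    using cplane.independent_span_bound[OF _ independent_monomial, of "p ` {..<n}" "- E"]
    by (simp add: span_p image_subset_iff monomial_in_supported_on)
  moreover have "card (monomial ` (- E)) = card (p ` {..<n})"
    using cplane.dim_eq_card[of "p ` {..<n}" "monomial ` (- E)"]
      cplane.dim_eq_card[of "monomial ` (- E)" "monomial ` (- E)"] p(2) independent_monomial
    by (simp add: span_p span_monomial)
  ultimately show "finite (- E) \<and> card (- E) = n"
    using p(1) inj_on_subset[OF inj_monomial] by (auto simp: card_image dest: finite_imageD)
next
  assume E: "finite (- E) \<and> card (- E) = n"
  then obtain h where h: "bij_betw h {..<n} (- E)"
    using ex_bij_betw_nat_finite[of "- E"] by (auto simp: atLeast0LessThan)
  have bicoeff_comb: "bicoeff (\<Sum>k<n. smult [:c k:] (monomial (h k))) (h l) = c l" if "l < n" for c l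
  proof -
    have "bicoeff (\<Sum>k<n. smult [:c k:] (monomial (h k))) (h l) = (\<Sum>k<n. if k = l then c k else 0)"
      unfolding bicoeff_sum using h that
      by (intro sum.cong) (auto simp: bicoeff_monomial bij_betw_def inj_on_def)
    then show ?thesis using that by simp
  qed
  have range_h: "h ` {..<n} = - E" using h by (rule bij_betw_imp_surj_on)
  show "quotient_dim (supported_on E) n"
    unfolding quotient_dim_def
  proof (intro exI[of _ "\<lambda>k. monomial (h k)"] conjI allI impI)
    fix f
    let ?g = "\<Sum>k<n. smult [:bicoeff f (h k):] (monomial (h k))"
    have "bicoeff (f - ?g) m = 0" if m: "m \<notin> E" for m
    proof -
      obtain k where "k < n" "m = h k" using m range_h by blast
      then show ?thesis using bicoeff_comb[of k "\<lambda>k. bicoeff f (h k)"] by simp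
    qed
    then have "f - ?g \<in> supported_on E" unfolding supported_on_iff by blast
    then show "\<exists>c. f - (\<Sum>k<n. smult [:c k:] (monomial (h k))) \<in> supported_on E"
      by (rule exI[where x = "\<lambda>k. bicoeff f (h k)"])
  next
    fix c k assume *: "(\<Sum>k<n. smult [:c k:] (monomial (h k))) \<in> supported_on E" "k < n"
    have "h k \<notin> E" using range_h *(2) by blast
    then have "bicoeff (\<Sum>k<n. smult [:c k:] (monomial (h k))) (h k) = 0"
      using *(1) unfolding supported_on_iff by blast
    then show "c k = 0" using bicoeff_comb[OF *(2)] by simp
  qed
qed

section \<open>Young diagrams\<close>

lemma young_diagram_eq:
  "young_diagram l = (\<lambda>(j, i). (i, j)) ` (SIGMA j:{..<length l}. {..<l ! j})"
  by (auto simp: young_diagram_def image_iff)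

lemma finite_young_diagram: "finite (young_diagram l)"
  by (simp add: young_diagram_eq)

lemma card_young_diagram: "card (young_diagram l) = sum_list l"
proof -
  have "card (young_diagram l) = card (SIGMA j:{..<length l}. {..<l ! j})"
    unfolding young_diagram_eq by (intro card_image inj_onI) auto
  then show ?thesis by (simp add: sum_list_sum_nth atLeast0LessThan)
qed

lemma finite_initial_segment_eq_lessThan:
  fixes N :: "nat set"
  assumes "finite N" "\<And>i k. i \<in> N \<Longrightarrow> k \<le> i \<Longrightarrow> k \<in> N"
  shows "N = {..<card N}"
proof (cases "N = {}")
  case False
  then have "N = {..Max N}" using assms Max_in by auto
  then show ?thesis by (metis card_atMost lessThan_Suc_atMost)
qed simp

text \<open>Each row of a finite down-closed set, and its first column, is an initial segment of
  \<open>\<nat>\<close> and hence determined by its cardinality. The row lengths are the parts of the partition, and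
  the length of the first column is the number of parts.\<close>

lemma young_diagram_of_finite_down_set:
  assumes fin: "finite D" and down: "up_closed (- D)"
  obtains l where "is_partition l" "young_diagram l = D"
proof
  define row where "row j = {i. (i, j) \<in> D}" for j
  define h where "h = card {j. (0, j) \<in> D}"
  define l where "l = map (\<lambda>j. card (row j)) [0..<h]"
  have downD: "(i', j') \<in> D" if "(i, j) \<in> D" "i' \<le> i" "j' \<le> j" for i j i' j'
    using down that unfolding up_closed_def by blast
  have fin_row: "finite (row j)" for j
    by (rule finite_subset[of _ "fst ` D"]) (use fin in \<open>force simp: row_def\<close>)+
  have "finite {j. (0, j) \<in> D}"
    by (rule finite_subset[of _ "snd ` D"]) (use fin in \<open>force\<close>)+
  then have "{j. (0, j) \<in> D} = {..<card {j. (0, j) \<in> D}}"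
    by (rule finite_initial_segment_eq_lessThan) (use downD in auto)
  then have height: "j < h \<longleftrightarrow> (0, j) \<in> D" for j unfolding h_def by blast
  have "row j = {..<card (row j)}" for j
    by (rule finite_initial_segment_eq_lessThan[OF fin_row]) (use downD in \<open>auto simp: row_def\<close>)
  then have width: "i < card (row j) \<longleftrightarrow> (i, j) \<in> D" for i j
    by (metis lessThan_iff mem_Collect_eq row_def)
  have l: "length l = h" "\<And>j. j < h \<Longrightarrow> l ! j = card (row j)"
    by (simp_all add: l_def)
  have "card (row j') \<le> card (row j)" if "j \<le> j'" for j j'
    using downD that by (intro card_mono fin_row) (auto simp: row_def)
  moreover have "0 < card (row j)" if "j < h" for j
    using that height width by simp
  ultimately show "is_partition l"
    by (auto simp: is_partition_def sorted_wrt_iff_nth_less l in_set_conv_nth)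
  have "(i, j) \<in> young_diagram l \<longleftrightarrow> (0, j) \<in> D \<and> (i, j) \<in> D" for i j
    using height width l by (auto simp: young_diagram_def)
  then show "young_diagram l = D"
    using downD by auto
qed

section \<open>The fixed points\<close>

theorem corollary5p12:
  fixes n :: nat
  shows "bij_betw (\<lambda>(l, c). (monomial_ideal l, monomial_ideal (remove_box l c)))
           {(l, c). l \<in> partitions_of (n + 1) \<and> c \<in> removable_corners l}
           (torus_fixed_points n)"
proof (rule bij_betw_imageI)
  show "inj_on (\<lambda>(l, c). (monomial_ideal l, monomial_ideal (remove_box l c)))
          {(l, c). l \<in> partitions_of (n + 1) \<and> c \<in> removable_corners l}"
  proof (rule inj_onI, clarify)
    fix l i j l' i' j'
    assume "l \<in> partitions_of (n + 1)" "l' \<in> partitions_of (n + 1)"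
      and c: "(i, j) \<in> removable_corners l" "(i', j') \<in> removable_corners l'"
      and eq: "monomial_ideal l = monomial_ideal l'"
        "monomial_ideal (remove_box l (i, j)) = monomial_ideal (remove_box l' (i', j'))"
    then have l: "is_partition l" "is_partition l'" by (auto simp: partitions_of_def)
    then have D: "young_diagram l = young_diagram l'"
      using eq(1) by (simp add: monomial_ideal_eq_supported_on supported_on_eq_iff)
    then have "l = l'" using l young_diagram_inj by blast
    moreover have "young_diagram l - {(i, j)} = young_diagram l - {(i', j')}"
      using eq(2) remove_box_well_defined[OF l(1) c(1)] remove_box_well_defined[OF l(2) c(2)]
      unfolding D by (metis monomial_ideal_eq_supported_on supported_on_eq_iff double_compl)
    moreover have "(i, j) \<in> young_diagram l" using c(1) by (simp add: removable_corners_def)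
    ultimately show "l = l' \<and> (i, j) = (i', j')" by blast
  qed
  show "(\<lambda>(l, c). (monomial_ideal l, monomial_ideal (remove_box l c))) `
          {(l, c). l \<in> partitions_of (n + 1) \<and> c \<in> removable_corners l} = torus_fixed_points n"
  proof (intro equalityI subsetI)
    fix P assume "P \<in> (\<lambda>(l, c). (monomial_ideal l, monomial_ideal (remove_box l c))) `
          {(l, c). l \<in> partitions_of (n + 1) \<and> c \<in> removable_corners l}"
    then obtain l c where l: "is_partition l" "sum_list l = n + 1"
      and c: "c \<in> removable_corners l"
      and P: "P = (monomial_ideal l, monomial_ideal (remove_box l c))"
      by (auto simp: partitions_of_def)
    note rb = remove_box_well_defined[OF l(1) c]
    have "c \<in> young_diagram l" using c by (auto simp: removable_corners_def)
    then have "card (young_diagram l - {c}) = n"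
      by (simp add: card_young_diagram l(2))
    then have dims: "quotient_dim (supported_on (- young_diagram l)) (n + 1)"
      "quotient_dim (supported_on (- (young_diagram l - {c}))) n"
      by (simp_all only: quotient_dim_supported_on_iff double_compl)
        (simp_all add: finite_young_diagram card_young_diagram l(2))
    have up: "up_closed (- young_diagram l)" "up_closed (- (young_diagram l - {c}))"
      using up_closed_Compl_young_diagram[OF l(1)] up_closed_Compl_young_diagram[OF rb(1)]
      by (simp_all only: rb(2))
    have "supported_on (- young_diagram l) \<subseteq> supported_on (- (young_diagram l - {c}))"
      unfolding supported_on_subset_iff by blast
    moreover have "P = (supported_on (- young_diagram l), supported_on (- (young_diagram l - {c})))"
      by (simp only: P monomial_ideal_eq_supported_on l(1) rb)
    ultimately show "P \<in> torus_fixed_points n"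
      using dims is_ideal_supported_on[OF up(1)] is_ideal_supported_on[OF up(2)]
      unfolding torus_fixed_points_def nested_hilbert_def torus_act_pair_def
      by (simp only: mem_Collect_eq case_prod_conv torus_act_supported_on simp_thms)
        (intro ballI, simp only: torus_act_supported_on)
  next
    fix P assume "P \<in> torus_fixed_points n"
    then obtain I J where P: "P = (I, J)" and ideals: "is_ideal I" "is_ideal J" and "I \<subseteq> J"
      and dims: "quotient_dim I (n + 1)" "quotient_dim J n"
      and fixed: "\<And>\<tau>. \<tau> \<in> torus \<Longrightarrow> torus_act_ideal \<tau> I = I"
        "\<And>\<tau>. \<tau> \<in> torus \<Longrightarrow> torus_act_ideal \<tau> J = J"
      by (auto simp: torus_fixed_points_def nested_hilbert_def torus_act_pair_def)
    obtain A where A: "up_closed A" "I = supported_on A"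
      using torus_stable_imp_supported_on[OF ideals(1) fixed(1)] by blast
    obtain B where B: "up_closed B" "J = supported_on B"
      using torus_stable_imp_supported_on[OF ideals(2) fixed(2)] by blast
    have card: "finite (- A)" "card (- A) = n + 1" "finite (- B)" "card (- B) = n"
      using dims by (simp_all add: A B quotient_dim_supported_on_iff)
    have "A \<subseteq> B" using \<open>I \<subseteq> J\<close> by (simp add: A B supported_on_subset_iff)
    then have "card (- A - - B) = 1"
      using card by (subst card_Diff_subset) auto
    then obtain c where "- A - - B = {c}" by (auto simp: card_1_singleton_iff)
    then have c: "- B = - A - {c}" "c \<notin> A" "c \<in> B" using \<open>A \<subseteq> B\<close> by auto
    obtain l where l: "is_partition l" "young_diagram l = - A"
      using young_diagram_of_finite_down_set[of "- A"] card(1) A(1) by auto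
    obtain i j where ij: "c = (i, j)" by (cases c)
    \<comment> \<open>\<open>c\<close> is a corner because the exponents of \<open>J\<close> are up-closed and contain \<open>c\<close>\<close>
    have "(i + 1, j) \<in> B" "(i, j + 1) \<in> B"
      using B(1) c(3) unfolding up_closed_def ij by (meson le_add1 order_refl)+
    moreover have "B = insert (i, j) A" using c ij \<open>A \<subseteq> B\<close> by blast
    ultimately have "(i + 1, j) \<in> A" "(i, j + 1) \<in> A" by simp_all
    then have corner: "c \<in> removable_corners l"
      using c(2) by (simp add: removable_corners_def l(2) ij)
    note rb = remove_box_well_defined[OF l(1) corner]
    have "sum_list l = n + 1" using card(2) card_young_diagram[of l] by (simp add: l(2))
    then have "l \<in> partitions_of (n + 1)" using l(1) by (simp add: partitions_of_def)
    moreover have "- (- A - {c}) = B" using c(1) by blast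
    then have "P = (monomial_ideal l, monomial_ideal (remove_box l c))"
      using l(1) rb by (simp add: P monomial_ideal_eq_supported_on l(2) A(2) B(2))
    ultimately show "P \<in> (\<lambda>(l, c). (monomial_ideal l, monomial_ideal (remove_box l c))) `
          {(l, c). l \<in> partitions_of (n + 1) \<and> c \<in> removable_corners l}"
      using corner by (auto intro!: rev_image_eqI)
  qed
qed

end
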